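(* Let $p$ be a nonnegative integer and let $t_m=m(m+1)/2$ denote the $m$-th triangular number. (i) For every even integer $n\ge 2$, $$ g\left(t_n,t_{n+1},t_{n+2};\,p(p+1)+\sum_{j=1}^p\left\lceil\frac{6 j}{n}\right\rceil\right)=\frac{(n+1)(n+2)\bigl(2(n+3)p+3 n\bigr)}{4}-1\,. $$ (ii) For every odd integer $n\ge 3$, $$ g\left(t_n,t_{n+1},t_{n+2};\,\sum_{j=1}^p\left\lceil\frac{j}{2}\left(1+\frac{3}{n}\right)\right\rceil\right)=\frac{(n+1)(n+2)\bigl((n+3)p+3(n-1)\bigr)}{4}-1\,. $$
   Context: For positive integers $a_1,\dots,a_k$ with $\gcd(a_1,\dots,a_k)=1$ and an integer $N$, let $d(N;a_1,\dots,a_k)$ denote the number of $k$-tuples $(x_1,\dots,x_k)$ of nonnegative integers with $a_1x_1+\cdots+a_kx_k=N$. For a nonnegative integer $q$, the generalized Frobenius number $g(a_1,\dots,a_k;q)$ is the largest integer $N$ such that $d(N;a_1,\dots,a_k)\le q$ (so every integer larger than it has at least $q+1$ representations; $q=0$ gives the classical Frobenius number). An empty sum equals $0$. It is known that $\gcd(t_n,t_{n+1},t_{n+2})=1$. *)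

theory Defs
  imports Complex_Main
begin

(* A tuple (x_1, ..., x_k) of nonnegative integers is a list xs of naturals with
   length xs = length as.  If all entries of as are positive, the set of solutions is finite,
   so card is the true count; for negative N it is empty. *)
definition num_reps :: "int \<Rightarrow> nat list \<Rightarrow> nat" where
  "num_reps N as =
     card {xs :: nat list. length xs = length as \<and>
                           (\<Sum>i<length as. int (as ! i) * int (xs ! i)) = N}"

(* The largest N ranges over all integers, hence GREATEST at type int.  For lists of
   at least two positive integers with gcd 1 such an N exists; otherwise the value may be
   unspecified. *)
definition gen_frobenius :: "nat list \<Rightarrow> nat \<Rightarrow> int" where
  "gen_frobenius as q = (GREATEST N :: int. num_reps N as \<le> q)"

definition triangular :: "nat \<Rightarrow> nat" where
  "triangular m = m * (m + 1) div 2"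

end

(* If the three moduli have the shape g a, g h, h b with g, h coprime to the moduli they do not divide,
   every integer is uniquely N = g a s + h b r + g h K with 0 <= s < h, 0 <= r < g, and a
   representation of N must be x = s + h v, z = r + g w, so that K = a v + y + b w.  Hence the number
   of representations of N is the number of (v, w) with a v + b w <= K, which increases with K.
   It jumps at K = b p because of (0, p), and below that it is the sum of the ceilings of j b / a.
   Consecutive triangular numbers have this shape, with factors depending on the parity of n. *)
theory Submission
  imports Defs "HOL-Number_Theory.Cong"
begin

section \<open>Lattice points in a right triangle\<close>

lemma card_nat_mult_less:
  fixes a c :: nat
  assumes "a > 0"
  shows "card {v. a * v < c} = nat \<lceil>real c / real a\<rceil>"
proof -
  have "a * v < c \<longleftrightarrow> v < nat \<lceil>real c / real a\<rceil>" for v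
  proof -
    have "a * v < c \<longleftrightarrow> real v < real c / real a"
      using assms by (simp add: pos_less_divide_eq mult.commute flip: of_nat_mult)
    also have "\<dots> \<longleftrightarrow> int v < \<lceil>real c / real a\<rceil>"
      by (simp add: less_ceiling_iff)
    finally show ?thesis by (simp add: zless_nat_eq_int_zless)
  qed
  then have "{v. a * v < c} = {..<nat \<lceil>real c / real a\<rceil>}" by auto
  then show ?thesis by simp
qed

lemma finite_lattice_triangle:
  fixes a b :: nat
  assumes "a > 0" "b > 0"
  shows "finite {(v, w). int (a * v + b * w) \<le> K}"
proof (rule finite_subset)
  show "{(v, w). int (a * v + b * w) \<le> K} \<subseteq> {..nat K} \<times> {..nat K}"
  proof clarsimp
    fix v w :: nat
    assume *: "int a * int v + int b * int w \<le> K"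
    have "v \<le> a * v" "w \<le> b * w" using assms by simp_all
    then have "int v \<le> int a * int v" "int w \<le> int b * int w"
      by (simp_all flip: of_nat_mult)
    with * show "v \<le> nat K \<and> w \<le> nat K" by linarith
  qed
qed simp

text \<open>Slice along \<open>w\<close>: row \<open>w\<close> is nonempty only for
  \<open>w < p\<close> and consists of the \<open>v\<close> with \<open>a * v < b * (p - w)\<close>.
  Strictness makes its size a ceiling, and \<open>j = p - w\<close> reverses the order of the
  rows.\<close>

lemma card_lattice_triangle:
  fixes a b p :: nat
  assumes "a > 0"
  shows "card {(v, w). a * v + b * w < b * p} = (\<Sum>j=1..p. nat \<lceil>real j * real b / real a\<rceil>)"
proof -
  have "{(v, w). a * v + b * w < b * p} = prod.swap ` (SIGMA w:{..<p}. {v. a * v < b * (p - w)})"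
  proof (intro equalityI subsetI)
    fix x assume "x \<in> {(v, w). a * v + b * w < b * p}"
    then obtain v w where x: "x = (v, w)" "a * v + b * w < b * p" by auto
    then have "b * w < b * p" by linarith
    then have "w < p" by simp
    moreover have "a * v < b * (p - w)"
      using x(2) by (simp add: diff_mult_distrib2)
    ultimately show "x \<in> prod.swap ` (SIGMA w:{..<p}. {v. a * v < b * (p - w)})"
      using x(1) by force
  next
    fix x assume "x \<in> prod.swap ` (SIGMA w:{..<p}. {v. a * v < b * (p - w)})"
    then show "x \<in> {(v, w). a * v + b * w < b * p}"
      by (auto simp: diff_mult_distrib2)
  qed
  then have "card {(v, w). a * v + b * w < b * p} = card (SIGMA w:{..<p}. {v. a * v < b * (p - w)})"
    by (simp add: card_image)
  also have "\<dots> = (\<Sum>w<p. card {v. a * v < b * (p - w)})"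
  proof (rule card_SigmaI)
    have "{v. a * v < c} \<subseteq> {..c}" for c
    proof clarsimp
      fix v assume "a * v < c"
      moreover have "v \<le> a * v" using assms by simp
      ultimately show "v \<le> c" by linarith
    qed
    then show "\<forall>w\<in>{..<p}. finite {v. a * v < b * (p - w)}"
      by (meson finite_atMost finite_subset)
  qed simp
  also have "\<dots> = (\<Sum>w<p. nat \<lceil>real (p - w) * real b / real a\<rceil>)"
    by (simp only: card_nat_mult_less[OF assms] of_nat_mult mult.commute[of "real b"])
  also have "\<dots> = (\<Sum>j=1..p. nat \<lceil>real j * real b / real a\<rceil>)"
    by (rule sum.reindex_bij_witness[where i = "\<lambda>j. p - j" and j = "\<lambda>w. p - w"]) auto
  finally show ?thesis .
qed

section \<open>Residues and the decomposition of integers\<close>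

lemma residue_solution:
  fixes c N :: int and g :: nat
  assumes "coprime c (int g)" "g > 0"
  obtains r where "r < g" "int g dvd N - c * int r"
proof -
  obtain x where x: "[c * x = 1] (mod int g)"
    using cong_solve_coprime_int[OF assms(1)] by blast
  let ?r = "(x * N) mod int g"
  have "[c * ?r = c * (x * N)] (mod int g)"
    by (simp add: cong_def mod_simps)
  also have "c * (x * N) = c * x * N" by simp
  also have "[c * x * N = 1 * N] (mod int g)"
    using x by (rule cong_scalar_right)
  finally have "int g dvd c * ?r - N" by (simp add: cong_iff_dvd_diff)
  then have "int g dvd N - c * ?r" by (subst dvd_diff_commute)
  moreover have "0 \<le> ?r" "?r < int g" using assms(2) by simp_all
  ultimately show ?thesis
    using that[of "nat ?r"] by (simp add: nat_less_iff)
qed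

text \<open>Modulo \<open>g\<close> only the \<open>r\<close> term survives and modulo
  \<open>h\<close> only the \<open>s\<close> term, with invertible coefficients, so each digit
  solves one congruence. What remains is divisible by both \<open>g\<close> and \<open>h\<close>,
  hence by their product.\<close>

lemma mixed_radix_decomposition:
  fixes a b g h :: nat and N :: int
  assumes g: "coprime g (h * b)" "g > 0" and h: "coprime h (g * a)" "h > 0"
  obtains r s K where "r < g" "s < h"
    "N = int (g * a * s) + int (h * b * r) + int (g * h) * K"
proof -
  obtain r where r: "r < g" "int g dvd N - int (h * b) * int r"
    using residue_solution[of "int (h * b)" g N] g by (metis coprime_commute coprime_int_iff)
  obtain s where s: "s < h" "int h dvd N - int (g * a) * int s"
    using residue_solution[of "int (g * a)" h N] h by (metis coprime_commute coprime_int_iff)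
  let ?M = "N - int (g * a * s) - int (h * b * r)"
  have "?M = (N - int (h * b) * int r) - int g * int (a * s)" by simp
  then have "int g dvd ?M" using r(2) by (metis dvd_diff dvd_triv_left)
  moreover have "?M = (N - int (g * a) * int s) - int h * int (b * r)" by simp
  then have "int h dvd ?M" using s(2) by (metis dvd_diff dvd_triv_left)
  moreover have "coprime (int g) (int h)" using g(1) by simp
  ultimately have "int g * int h dvd ?M" by (rule divides_mult)
  then obtain K where "?M = int (g * h) * K" by (auto simp: dvd_def)
  then show ?thesis using that[of r s K] r(1) s(1) by (simp add: algebra_simps)
qed

text \<open>Cancelling the invertible \<open>c\<close> gives x congruent to s modulo h. As
  \<open>s < h\<close>, \<open>s\<close> is the remainder of \<open>x\<close>, so the quotient
  \<open>v\<close> is a natural number and no negative shift can occur.\<close>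

lemma residue_split:
  fixes c x s h :: nat
  assumes "coprime h c" "s < h" "int h dvd int c * int x - int c * int s"
  obtains v where "x = s + h * v"
proof -
  have "int h dvd int c * (int x - int s)" using assms(3) by (simp add: algebra_simps)
  then have "int h dvd int x - int s"
    using assms(1) by (simp add: coprime_dvd_mult_right_iff)
  then have "[int x = int s] (mod int h)" by (simp add: cong_iff_dvd_diff)
  then have "[x = s] (mod h)" by (simp add: cong_int_iff)
  then have "x mod h = s" using assms(2) by (simp add: cong_def)
  then have "x = s + h * (x div h)" by (metis mod_mult_div_eq)
  then show ?thesis by (rule that)
qed

section \<open>Counting representations\<close>

lemma num_reps_3:
  "num_reps N [a1, a2, a3] =
     card {(x, y, z). int a1 * int x + int a2 * int y + int a3 * int z = N}"
  (is "_ = card ?T")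
proof -
  have "{xs :: nat list. length xs = length [a1, a2, a3] \<and>
      (\<Sum>i<length [a1, a2, a3]. int ([a1, a2, a3] ! i) * int (xs ! i)) = N} =
    (\<lambda>(x, y, z). [x, y, z]) ` ?T"
    by (auto simp: length_Suc_conv numeral_3_eq_3 image_iff)
  moreover have "inj_on (\<lambda>(x, y, z). [x, y, z]) ?T" by (auto simp: inj_on_def)
  ultimately show ?thesis unfolding num_reps_def by (simp add: card_image)
qed

text \<open>Once the residues of \<open>x\<close> and \<open>z\<close> are fixed, the middle
  coefficient \<open>g * h\<close> lets \<open>y\<close> absorb the slack: a pair
  \<open>(v, w)\<close> extends to a representation exactly when \<open>K - a * v - b * w\<close> is
  nonnegative.\<close>

lemma num_reps_eq_card_triangle:
  fixes a b g h :: nat and K :: int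
  assumes g: "coprime g (h * b)" and h: "coprime h (g * a)"
    and r: "r < g" and s: "s < h"
    and N: "N = int (g * a * s) + int (h * b * r) + int (g * h) * K"
  shows "num_reps N [g * a, g * h, h * b] = card {(v, w). int (a * v + b * w) \<le> K}"
proof -
  let ?T = "{(v, w). int (a * v + b * w) \<le> K}"
  let ?S = "{(x, y, z). int (g * a) * int x + int (g * h) * int y + int (h * b) * int z = N}"
  \<comment> \<open>On \<open>?T\<close> the difference is nonnegative, so \<open>nat\<close> loses
    nothing there.\<close>
  define f where "f = (\<lambda>(v, w). (s + h * v, nat (K - int (a * v + b * w)), r + g * w))"
  have pos: "g > 0" "h > 0" using r s by auto
  have "inj_on f ?T" using pos by (auto simp: inj_on_def f_def)
  moreover have "f ` ?T = ?S"
  proof (intro equalityI subsetI)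
    fix t assume "t \<in> f ` ?T"
    then show "t \<in> ?S" by (auto simp: f_def N algebra_simps)
  next
    fix t assume "t \<in> ?S"
    then obtain x y z where t: "t = (x, y, z)"
      and eq: "int (g * a) * int x + int (g * h) * int y + int (h * b) * int z = N"
      by auto
    \<comment> \<open>All terms of the equation other than those in \<open>x\<close> and
      \<open>s\<close> contain \<open>h\<close>, so \<open>h\<close> divides this
      difference.\<close>
    have "int (g * a) * int x - int (g * a) * int s =
        int h * (int (b * r) + int g * K - int (g * y) - int (b * z))"
      using eq unfolding N by (simp add: algebra_simps)
    then obtain v where v: "x = s + h * v"
      using residue_split[OF h s] by (metis dvd_triv_left)
    have "int (h * b) * int z - int (h * b) * int r =
        int g * (int (a * s) + int h * K - int (h * y) - int (a * x))"
      using eq unfolding N by (simp add: algebra_simps)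
    then obtain w where w: "z = r + g * w"
      using residue_split[OF g r] by (metis dvd_triv_left)
    have "int (g * h) * (int (a * v) + int y + int (b * w)) = int (g * h) * K"
      using eq unfolding N v w by (simp add: algebra_simps)
    then have "int (a * v) + int y + int (b * w) = K" using pos by simp
    then have "f (v, w) = t" "(v, w) \<in> ?T" by (auto simp: f_def t v w)
    then show "t \<in> f ` ?T" by blast
  qed
  ultimately have "card ?S = card ?T" by (metis card_image)
  then show ?thesis by (simp add: num_reps_3)
qed

text \<open>\<open>?F\<close> takes every digit as large as possible: \<open>s = h - 1\<close>,
  \<open>r = g - 1\<close>, and \<open>K = b * p - 1\<close>, the last value at which the count is
  still at most \<open>?q\<close>.\<close>

lemma gen_frobenius_factored:
  fixes a b g h p :: nat
  assumes g: "coprime g (h * b)" "g > 0" and h: "coprime h (g * a)" "h > 0"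
    and ab: "a > 0" "b > 0"
  shows "gen_frobenius [g * a, g * h, h * b] (\<Sum>j=1..p. nat \<lceil>real j * real b / real a\<rceil>) =
    int (g * a * (h - 1)) + int (h * b * (g - 1)) + int (g * h) * (int (b * p) - 1)"
    (is "gen_frobenius ?L ?q = ?F")
  unfolding gen_frobenius_def
proof (rule Greatest_equality)
  \<comment> \<open>For \<open>p = 0\<close> the bound is -1 and both sets are empty, matching the
    empty sum.\<close>
  have below: "{(v, w). int (a * v + b * w) \<le> int (b * p) - 1} = {(v, w). a * v + b * w < b * p}"
    by (auto simp flip: of_nat_mult of_nat_add)
  have q: "card {(v, w). int (a * v + b * w) \<le> int (b * p) - 1} = ?q"
    unfolding below by (rule card_lattice_triangle[OF ab(1)])
  show "num_reps ?F ?L \<le> ?q"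
    using num_reps_eq_card_triangle[OF g(1) h(1), of "g - 1" "h - 1" ?F "int (b * p) - 1"] g(2) h(2) q
    by simp
  fix N assume N: "num_reps N ?L \<le> ?q"
  obtain r s K where rsK: "r < g" "s < h"
    "N = int (g * a * s) + int (h * b * r) + int (g * h) * K"
    using mixed_radix_decomposition[OF g h] by metis
  have K: "K \<le> int (b * p) - 1"
  proof (rule ccontr)
    assume "\<not> ?thesis"
    then have K: "int (b * p) \<le> K" by simp
    \<comment> \<open>The pair \<open>(0, p)\<close> attains the value \<open>b * p\<close> exactly:
      it lies in \<open>?B\<close> but not in \<open>?A\<close>, so the count exceeds
      \<open>?q\<close>.\<close>
    have "insert (0, p) {(v, w). int (a * v + b * w) \<le> int (b * p) - 1} \<subseteq>
        {(v, w). int (a * v + b * w) \<le> K}" (is "insert _ ?A \<subseteq> ?B")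
      using K by auto
    then have "card (insert (0, p) ?A) \<le> card ?B"
      by (intro card_mono finite_lattice_triangle ab)
    moreover have "card (insert (0, p) ?A) = Suc (card ?A)"
      by (intro card_insert_disjoint finite_lattice_triangle ab) simp
    ultimately show False
      using N q num_reps_eq_card_triangle[OF g(1) h(1) rsK] by simp
  qed
  have "g * a * s \<le> g * a * (h - 1)" "h * b * r \<le> h * b * (g - 1)"
    using rsK(1,2) by (auto intro!: mult_le_mono2)
  then have "int (g * a * s) \<le> int (g * a * (h - 1))" "int (h * b * r) \<le> int (h * b * (g - 1))"
    by (simp_all only: of_nat_le_iff)
  moreover have "int (g * h) * K \<le> int (g * h) * (int (b * p) - 1)"
    using K by (intro mult_left_mono) auto
  ultimately show "N \<le> ?F" unfolding rsK(3) by linarith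
qed

section \<open>Consecutive triangular numbers\<close>

lemma coprime_nat_linear:
  fixes u v :: nat
  assumes "int u * x + int v * y = 1"
  shows "coprime u v"
proof -
  have "coprime (int u) (int v)"
    using assms by (metis coprimeI dvd_add dvd_mult2)
  then show ?thesis by simp
qed

text \<open>With \<open>n = 2 * k\<close> the factors are \<open>g = 2 * k + 1\<close>,
  \<open>h = k + 1\<close>, \<open>a = k\<close> and \<open>b = 2 * k + 3\<close>. The bound
  \<open>n \<ge> 2\<close> supplies \<open>a > 0\<close>.\<close>

lemma gen_frobenius_triangular_even:
  fixes n p :: nat
  assumes "even n" "n \<ge> 2"
  shows "real_of_int (gen_frobenius [triangular n, triangular (n + 1), triangular (n + 2)]
              (p * (p + 1) + (\<Sum>j=1..p. nat \<lceil>6 * real j / real n\<rceil>)))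
            = (real n + 1) * (real n + 2) * (2 * (real n + 3) * real p + 3 * real n) / 4 - 1"
proof -
  obtain k where k: "n = 2 * k" "k > 0" using assms by (auto elim: evenE)
  have tri: "triangular n = (2 * k + 1) * k" "triangular (n + 1) = (2 * k + 1) * (k + 1)"
    "triangular (n + 2) = (k + 1) * (2 * k + 3)"
  proof -
    have "2 * k * (2 * k + 1) = 2 * ((2 * k + 1) * k)"
      "(2 * k + 1) * (2 * k + 1 + 1) = 2 * ((2 * k + 1) * (k + 1))"
      "(2 * k + 2) * (2 * k + 2 + 1) = 2 * ((k + 1) * (2 * k + 3))"
      by (simp_all add: algebra_simps)
    then show "triangular n = (2 * k + 1) * k" "triangular (n + 1) = (2 * k + 1) * (k + 1)"
      "triangular (n + 2) = (k + 1) * (2 * k + 3)"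
      unfolding triangular_def k by (metis nonzero_mult_div_cancel_left zero_neq_numeral)+
  qed
  \<comment> \<open>Here b/a = 2 + 3/k = 2 + 6/n, so the integer 2j leaves the ceiling; these
    integers add up to \<open>p * (p + 1)\<close>.\<close>
  have ceil: "nat \<lceil>real j * real (2 * k + 3) / real k\<rceil> = 2 * j + nat \<lceil>6 * real j / real n\<rceil>" for j
  proof -
    have "real j * real (2 * k + 3) / real k = 6 * real j / real n + real_of_int (int (2 * j))"
      using k by (simp add: field_simps)
    then have "\<lceil>real j * real (2 * k + 3) / real k\<rceil> = \<lceil>6 * real j / real n\<rceil> + int (2 * j)"
      by (metis ceiling_add_of_int)
    moreover have "0 \<le> \<lceil>6 * real j / real n\<rceil>"
      by (rule order_trans[OF _ ceiling_mono[of 0]]) auto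
    ultimately show ?thesis by (simp add: nat_add_distrib)
  qed
  have "(\<Sum>j=1..p. 2 * j) = p * (p + 1)" by (induction p) auto
  then have q: "p * (p + 1) + (\<Sum>j=1..p. nat \<lceil>6 * real j / real n\<rceil>) =
      (\<Sum>j=1..p. nat \<lceil>real j * real (2 * k + 3) / real k\<rceil>)"
    by (simp only: ceil sum.distrib)
  have 1: "coprime (2 * k + 1) ((k + 1) * (2 * k + 3))"
    unfolding coprime_mult_right_iff
  proof
    show "coprime (2 * k + 1) (k + 1)"
      by (rule coprime_nat_linear[of _ "- 1" _ 2]) simp
    show "coprime (2 * k + 1) (2 * k + 3)"
      \<comment> \<open>Bezout identity: (k + 1)(2k + 3) - (k + 2)(2k + 1) = 1.\<close>
      by (rule coprime_nat_linear[of _ "- int k - 2" _ "int k + 1"]) (simp add: algebra_simps)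
  qed
  have 2: "coprime (k + 1) ((2 * k + 1) * k)"
    unfolding coprime_mult_right_iff
  proof
    show "coprime (k + 1) (2 * k + 1)"
      by (rule coprime_nat_linear[of _ 2 _ "- 1"]) simp
    show "coprime (k + 1) k"
      by (rule coprime_nat_linear[of _ 1 _ "- 1"]) simp
  qed
  show ?thesis
    unfolding q tri
    by (subst gen_frobenius_factored[OF 1 _ 2]) (use k in \<open>simp_all add: field_simps\<close>)
qed

text \<open>With \<open>n = 2 * k + 1\<close> the factor 2 cancels from \<open>n + 1\<close> and
  \<open>n + 3\<close> instead, giving \<open>g = k + 1\<close>, \<open>h = 2 * k + 3\<close>,
  \<open>a = 2 * k + 1\<close> and \<open>b = k + 2\<close>.\<close>

lemma gen_frobenius_triangular_odd:
  fixes n p :: nat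
  assumes "odd n"
  shows "real_of_int (gen_frobenius [triangular n, triangular (n + 1), triangular (n + 2)]
              (\<Sum>j=1..p. nat \<lceil>real j / 2 * (1 + 3 / real n)\<rceil>))
            = (real n + 1) * (real n + 2) * ((real n + 3) * real p + 3 * (real n - 1)) / 4 - 1"
proof -
  obtain k where k: "n = 2 * k + 1" using assms by (auto elim: oddE)
  have tri: "triangular n = (k + 1) * (2 * k + 1)" "triangular (n + 1) = (k + 1) * (2 * k + 3)"
    "triangular (n + 2) = (2 * k + 3) * (k + 2)"
  proof -
    have "(2 * k + 1) * (2 * k + 1 + 1) = 2 * ((k + 1) * (2 * k + 1))"
      "(2 * k + 1 + 1) * (2 * k + 1 + 1 + 1) = 2 * ((k + 1) * (2 * k + 3))"
      "(2 * k + 1 + 2) * (2 * k + 1 + 2 + 1) = 2 * ((2 * k + 3) * (k + 2))"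
      by (simp_all add: algebra_simps)
    then show "triangular n = (k + 1) * (2 * k + 1)" "triangular (n + 1) = (k + 1) * (2 * k + 3)"
      "triangular (n + 2) = (2 * k + 3) * (k + 2)"
      unfolding triangular_def k by (metis nonzero_mult_div_cancel_left zero_neq_numeral)+
  qed
  \<comment> \<open>Since k + 2 = (n + 3)/2 and 2k + 1 = n, the ratio b/a is (1 + 3/n)/2.\<close>
  have ratio: "real j / 2 * (1 + 3 / real n) = real j * real (k + 2) / real (2 * k + 1)" for j
    unfolding k by (simp add: field_simps)
  have 1: "coprime (k + 1) ((2 * k + 3) * (k + 2))"
    unfolding coprime_mult_right_iff
  proof
    show "coprime (k + 1) (2 * k + 3)"
      by (rule coprime_nat_linear[of _ "- 2" _ 1]) simp
    show "coprime (k + 1) (k + 2)"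
      by (rule coprime_nat_linear[of _ "- 1" _ 1]) simp
  qed
  have 2: "coprime (2 * k + 3) ((k + 1) * (2 * k + 1))"
    unfolding coprime_mult_right_iff
  proof
    show "coprime (2 * k + 3) (k + 1)"
      by (rule coprime_nat_linear[of _ 1 _ "- 2"]) simp
    show "coprime (2 * k + 3) (2 * k + 1)"
      \<comment> \<open>Bezout identity: (k + 1)(2k + 1) - k(2k + 3) = 1.\<close>
      by (rule coprime_nat_linear[of _ "- int k" _ "int k + 1"]) (simp add: algebra_simps)
  qed
  show ?thesis
    unfolding ratio tri
    by (subst gen_frobenius_factored[OF 1 _ 2]) (simp_all add: k field_simps)
qed

theorem theorem1:
  fixes p :: nat
  shows "(\<forall>n::nat. even n \<and> n \<ge> 2 \<longrightarrow>
            real_of_int (gen_frobenius [triangular n, triangular (n + 1), triangular (n + 2)]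
              (p * (p + 1) + (\<Sum>j=1..p. nat \<lceil>6 * real j / real n\<rceil>)))
            = (real n + 1) * (real n + 2) * (2 * (real n + 3) * real p + 3 * real n) / 4 - 1)
       \<and> (\<forall>n::nat. odd n \<and> n \<ge> 3 \<longrightarrow>
            real_of_int (gen_frobenius [triangular n, triangular (n + 1), triangular (n + 2)]
              (\<Sum>j=1..p. nat \<lceil>real j / 2 * (1 + 3 / real n)\<rceil>))
            = (real n + 1) * (real n + 2) * ((real n + 3) * real p + 3 * (real n - 1)) / 4 - 1)"
  using gen_frobenius_triangular_even gen_frobenius_triangular_odd by blast

end
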